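(* For every upper semianalytic function $\psi:\Omega\to\mathbb R$ and every $(t,\omega)\in\mathbb R_+\times\Omega$, $$\sup_{P\in\mathcal C(t,\omega)}E^P\big[\psi\big]=\sup_{P\in\mathcal R(t,\omega)}E^P\big[\psi(\omega\,\widetilde\otimes_t\,X)\big].$$
   Context: Fix $d\in\mathbb N$. $\Omega$ is the space of continuous functions $\mathbb R_+\to\mathbb R^d$ with the topology of local uniform convergence, $\mathcal F=\mathcal B(\Omega)$, $X_t(\omega)=\omega(t)$ is the canonical process, $\mathcal F_t=\sigma(X_s,s\le t)$, $\mathbf F=(\mathcal F_t)_{t\ge0}$ (not made right-continuous). $\mathfrak P(\Omega)$ is the set of probability measures on $(\Omega,\mathcal F)$. $\mathbb S^d_+$: real symmetric positive semidefinite $d\times d$ matrices; $\lambda$: Lebesgue measure. $F$ is a metrizable space, and $b:F\times\mathbb R_+\times\Omega\to\mathbb R^d$, $a:F\times\mathbb R_+\times\Omega\to\mathbb S^d_+$ are Borel functions such that, for every $f\in F$, $(t,\omega)\mapsto b(f,t,\omega)$ and $(t,\omega)\mapsto a(f,t,\omega)$ are $\mathbf F$-predictable. $\Theta(t,\omega):=\{(b(f,t,\omega),a(f,t,\omega)):f\in F\}$. $\mathfrak P_{\mathrm{sem}}(t)$ is the set of $P\in\mathfrak P(\Omega)$ under which $X_{\cdot+t}=(X_{s+t})_{s\ge0}$ is a continuous semimartingale for its natural right-continuous filtration, with characteristics (finite-variation part, quadratic variation of the local martingale part) $(B^P_{\cdot+t},C^P_{\cdot+t})$; $\mathfrak P^{\mathrm{ac}}_{\mathrm{sem}}(t)$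 is the subset of those $P$ for which these are $P$-a.s. absolutely continuous w.r.t. $\lambda$; $\mathfrak P^{\mathrm{ac}}_{\mathrm{sem}}:=\mathfrak P^{\mathrm{ac}}_{\mathrm{sem}}(0)$. Put $\omega^t:=\omega(\cdot\wedge t)$, $X^t:=X_{\cdot\wedge t}$, $\omega\otimes_t\omega':=\omega\mathbf 1_{[0,t)}+(\omega(t)+\omega'-\omega'(t))\mathbf 1_{[t,\infty)}$, $\omega\,\widetilde\otimes_t\,\omega':=\omega\mathbf 1_{[0,t)}+(\omega(t)+\omega'(\cdot-t)-\omega'(0))\mathbf 1_{[t,\infty)}$, $$\mathcal C(t,\omega):=\{P\in\mathfrak P^{\mathrm{ac}}_{\mathrm{sem}}(t):P(X^t=\omega^t)=1,\ (\lambda\otimes P)\text{-a.e. }(dB^P_{\cdot+t}/d\lambda,dC^P_{\cdot+t}/d\lambda)\in\Theta(\cdot+t,\omega\otimes_tX)\},$$ $$\mathcal R(t,\omega):=\{P\in\mathfrak P^{\mathrm{ac}}_{\mathrm{sem}}:P\circ X_0^{-1}=\delta_{\omega(t)},\ (\lambda\otimes P)\text{-a.e. }(dB^P/d\lambda,dC^P/d\lambda)\in\Theta(\cdot+t,\omega\,\widetilde\otimes_t\,X)\}.$$ Standing assumptions: the graph of $\Theta$ is a Borel subset of $\mathbb R_+\times\Omega\times\mathbb R^d\times\mathbb S^d_+$, and $\mathcal C(t,\omega)\neq\emptyset$ for all $(t,\omega)$. $\psi$ is upper semianalytic if $\{\psi>c\}$ is analytic for every $c\in\mathbb R$. Expectations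 of such functions are with respect to the completed measure, with $E^P[\xi]:=-\infty$ if $E^P[\xi^+]=E^P[\xi^-]=\infty$. *)

theory Defs
  imports "HOL-Probability.Probability"
begin

section \<open>Path space\<close>

lemma restrict_continuous_extensional:
  assumes "continuous_on S f"
  shows "continuous_on S (restrict f S) \<and> restrict f S \<in> extensional S"
proof
  have "continuous_on S (restrict f S) = continuous_on S f"
    by (rule continuous_on_cong) auto
  then show "continuous_on S (restrict f S)" using assms by blast
qed (rule restrict_extensional)

text \<open>
  Continuous functions from the nonnegative half-line to \<open>real ^ 'd\<close>. The time parameter has type
  \<^typ>\<open>real\<close>; extensionality pins down the irrelevant values at negative times, so that equality of
  paths is equality on \<open>{0..}\<close>.
\<close>

typedef (overloaded) ('d::finite) cpath =
  "{w :: real \<Rightarrow> real ^ 'd. continuous_on {0..} w \<and> w \<in> extensional {0..}}"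
  morphisms path_at Abs_cpath
proof
  show "restrict (\<lambda>_. 0) {0..} \<in>
      {w :: real \<Rightarrow> real ^ 'd. continuous_on {0..} w \<and> w \<in> extensional {0..}}"
    by (intro CollectI restrict_continuous_extensional continuous_on_const)
qed

setup_lifting type_definition_cpath

text \<open>Topology of local uniform convergence.\<close>

instantiation cpath :: (finite) topological_space
begin

definition open_cpath :: "'a cpath set \<Rightarrow> bool" where
  "open_cpath U \<longleftrightarrow> (\<forall>w\<in>U. \<exists>T\<ge>0. \<exists>e>0. \<forall>v.
     (\<forall>s\<in>{0..T}. dist (path_at v s) (path_at w s) < e) \<longrightarrow> v \<in> U)"

instance
proof
  show "open (UNIV :: 'a cpath set)"
    unfolding open_cpath_def by (intro ballI exI[of _ "0::real"] exI[of _ "1::real"] conjI) auto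
next
  fix S T :: "'a cpath set"
  assume S: "open S" and T: "open T"
  show "open (S \<inter> T)"
    unfolding open_cpath_def
  proof
    fix w assume w: "w \<in> S \<inter> T"
    obtain T1 e1 where S1: "T1 \<ge> 0" "e1 > 0"
      "\<And>v. (\<forall>s\<in>{0..T1}. dist (path_at v s) (path_at w s) < e1) \<Longrightarrow> v \<in> S"
      using S w unfolding open_cpath_def by blast
    obtain T2 e2 where T2: "T2 \<ge> 0" "e2 > 0"
      "\<And>v. (\<forall>s\<in>{0..T2}. dist (path_at v s) (path_at w s) < e2) \<Longrightarrow> v \<in> T"
      using T w unfolding open_cpath_def by blast
    have "\<forall>v. (\<forall>s\<in>{0..max T1 T2}. dist (path_at v s) (path_at w s) < min e1 e2) \<longrightarrow> v \<in> S \<inter> T"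
    proof (intro allI impI IntI)
      fix v assume "\<forall>s\<in>{0..max T1 T2}. dist (path_at v s) (path_at w s) < min e1 e2"
      then show "v \<in> S" "v \<in> T"
        by (auto intro!: S1(3) T2(3))
    qed
    moreover have "max T1 T2 \<ge> 0" "min e1 e2 > 0" using S1 T2 by auto
    ultimately show "\<exists>T'\<ge>0. \<exists>e>0. \<forall>v. (\<forall>s\<in>{0..T'}. dist (path_at v s) (path_at w s) < e) \<longrightarrow> v \<in> S \<inter> T"
      by blast
  qed
next
  fix K :: "'a cpath set set"
  assume K: "\<forall>S\<in>K. open S"
  show "open (\<Union>K)"
    unfolding open_cpath_def
  proof
    fix w assume "w \<in> \<Union>K"
    then obtain S where S: "S \<in> K" "w \<in> S" by blast
    then obtain T e where "T \<ge> 0" "e > 0"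
      "\<And>v. (\<forall>s\<in>{0..T}. dist (path_at v s) (path_at w s) < e) \<Longrightarrow> v \<in> S"
      using K unfolding open_cpath_def by blast
    then show "\<exists>T\<ge>0. \<exists>e>0. \<forall>v. (\<forall>s\<in>{0..T}. dist (path_at v s) (path_at w s) < e) \<longrightarrow> v \<in> \<Union>K"
      using S(1) by (meson UnionI)
  qed
qed

end

lift_definition stop_path :: "real \<Rightarrow> 'd::finite cpath \<Rightarrow> 'd cpath" is
  "\<lambda>t w. restrict (\<lambda>s. w (min s t)) {0..}"
proof -
  fix t :: real and w :: "real \<Rightarrow> real ^ 'd"
  assume w: "continuous_on {0..} w \<and> w \<in> extensional {0..}"
  have "continuous_on {0..} (\<lambda>s. w (min s t))"
  proof (cases "t < 0")
    case True
    then have "continuous_on {0..} (\<lambda>s. w (min s t)) = continuous_on {0..} (\<lambda>s::real. w t)"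
      by (intro continuous_on_cong) auto
    then show ?thesis by simp
  next
    case False
    then show ?thesis
      by (intro continuous_on_compose2[OF w[THEN conjunct1]])
         (auto intro: continuous_on_min continuous_on_id continuous_on_const)
  qed
  then show "continuous_on {0..} (restrict (\<lambda>s. w (min s t)) {0..}) \<and>
      restrict (\<lambda>s. w (min s t)) {0..} \<in> extensional {0..}"
    by (rule restrict_continuous_extensional)
qed

lemma continuous_on_splice:
  fixes f g :: "real \<Rightarrow> 'a::topological_space"
  assumes "0 \<le> t \<Longrightarrow> continuous_on {0..t} f" "continuous_on {max 0 t..} g"
    and "0 \<le> t \<Longrightarrow> f t = g t"
  shows "continuous_on {0..} (\<lambda>s. if s < t then f s else g s)"
proof (cases "0 \<le> t")
  case True
  have "continuous_on ({0..t} \<union> {t..}) (\<lambda>s. if s \<le> t then f s else g s)"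
    using assms True by (intro continuous_on_cases) (auto simp: max_def)
  moreover have "{0..t} \<union> {t..} = {0..}" using True by auto
  moreover have "(\<lambda>s. if s < t then f s else g s) = (\<lambda>s. if s \<le> t then f s else g s)"
    using assms(3) True by (auto simp: fun_eq_iff)
  ultimately show ?thesis by metis
next
  case False
  then have "continuous_on {0..} (\<lambda>s. if s < t then f s else g s) = continuous_on {0..} g"
    by (intro continuous_on_cong) auto
  then show ?thesis using assms(2) False by simp
qed

text \<open>
  \<open>concat_path t w v\<close> is \<open>w \<otimes>\<^sub>t v\<close>, where \<open>v\<close> keeps its own clock; in \<open>concat_shift t w v\<close>, the variant
  with a tilde, the clock of \<open>v\<close> is restarted at time \<open>t\<close>.
\<close>

lift_definition concat_path :: "real \<Rightarrow> 'd::finite cpath \<Rightarrow> 'd cpath \<Rightarrow> 'd cpath" is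
  "\<lambda>t w v. restrict (\<lambda>s. if s < t then w s else w t + v s - v t) {0..}"
proof -
  fix t :: real and w v :: "real \<Rightarrow> real ^ 'd"
  assume w: "continuous_on {0..} w \<and> w \<in> extensional {0..}"
    and v: "continuous_on {0..} v \<and> v \<in> extensional {0..}"
  have "continuous_on {0..} (\<lambda>s. if s < t then w s else w t + v s - v t)"
  proof (rule continuous_on_splice)
    show "continuous_on {0..t} w" by (rule continuous_on_subset[of "{0..}"]) (use w in auto)
    have "continuous_on {max 0 t..} v" by (rule continuous_on_subset[of "{0..}"]) (use v in auto)
    then show "continuous_on {max 0 t..} (\<lambda>s. w t + v s - v t)" by (intro continuous_intros)
  qed simp
  then show "continuous_on {0..} (restrict (\<lambda>s. if s < t then w s else w t + v s - v t) {0..}) \<and>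
      restrict (\<lambda>s. if s < t then w s else w t + v s - v t) {0..} \<in> extensional {0..}"
    by (rule restrict_continuous_extensional)
qed

lift_definition concat_shift :: "real \<Rightarrow> 'd::finite cpath \<Rightarrow> 'd cpath \<Rightarrow> 'd cpath" is
  "\<lambda>t w v. restrict (\<lambda>s. if s < t then w s else w t + v (s - t) - v 0) {0..}"
proof -
  fix t :: real and w v :: "real \<Rightarrow> real ^ 'd"
  assume w: "continuous_on {0..} w \<and> w \<in> extensional {0..}"
    and v: "continuous_on {0..} v \<and> v \<in> extensional {0..}"
  have "continuous_on {0..} (\<lambda>s. if s < t then w s else w t + v (s - t) - v 0)"
  proof (rule continuous_on_splice)
    show "continuous_on {0..t} w" by (rule continuous_on_subset[of "{0..}"]) (use w in auto)
    have "continuous_on {max 0 t..} (\<lambda>s. v (s - t))"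
      by (rule continuous_on_compose2[OF v[THEN conjunct1]])
         (auto intro: continuous_on_diff continuous_on_id continuous_on_const)
    then show "continuous_on {max 0 t..} (\<lambda>s. w t + v (s - t) - v 0)"
      by (intro continuous_on_add continuous_on_diff continuous_on_const)
  qed simp
  then show "continuous_on {0..} (restrict (\<lambda>s. if s < t then w s else w t + v (s - t) - v 0) {0..}) \<and>
      restrict (\<lambda>s. if s < t then w s else w t + v (s - t) - v 0) {0..} \<in> extensional {0..}"
    by (rule restrict_continuous_extensional)
qed


section \<open>Filtrations and predictability\<close>

text \<open>
  Filtrations are families \<open>G :: real \<Rightarrow> 'w measure\<close> of sigma-algebras on the whole type \<open>'w\<close>, of which only
  the members with nonnegative index matter. None of them is completed.
\<close>

definition natural_filtration ::
    "(real \<Rightarrow> 'w \<Rightarrow> 'e::topological_space) \<Rightarrow> real \<Rightarrow> 'w measure" where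
  "natural_filtration Y s = sigma UNIV {Y r -` A | r A. 0 \<le> r \<and> r \<le> s \<and> A \<in> sets borel}"

definition right_cont_filtration :: "(real \<Rightarrow> 'w measure) \<Rightarrow> real \<Rightarrow> 'w measure" where
  "right_cont_filtration G s = sigma UNIV (\<Inter>u\<in>{s<..}. sets (G u))"

definition adapted :: "(real \<Rightarrow> 'w measure) \<Rightarrow> (real \<Rightarrow> 'w \<Rightarrow> 'e::topological_space) \<Rightarrow> bool" where
  "adapted G Y \<longleftrightarrow> (\<forall>s\<ge>0. Y s \<in> borel_measurable (G s))"

text \<open>Generated by the real-valued left-continuous adapted processes.\<close>

definition predictable_sigma :: "(real \<Rightarrow> 'w measure) \<Rightarrow> (real \<times> 'w) measure" where
  "predictable_sigma G = sigma ({0..} \<times> UNIV)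
     {{(s, w). 0 \<le> s \<and> Y s w \<in> A} | (Y :: real \<Rightarrow> 'w \<Rightarrow> real) A.
        adapted G Y \<and> (\<forall>w. \<forall>s>0. continuous (at_left s) (\<lambda>u. Y u w)) \<and> A \<in> sets borel}"

definition predictable :: "(real \<Rightarrow> 'w measure) \<Rightarrow> (real \<Rightarrow> 'w \<Rightarrow> 'e::topological_space) \<Rightarrow> bool" where
  "predictable G Y \<longleftrightarrow> (\<lambda>(s, w). Y s w) \<in> borel_measurable (predictable_sigma G)"


section \<open>Continuous semimartingales and their characteristics\<close>

definition martingale :: "'w measure \<Rightarrow> (real \<Rightarrow> 'w measure) \<Rightarrow> (real \<Rightarrow> 'w \<Rightarrow> real) \<Rightarrow> bool" where
  "martingale P G M \<longleftrightarrow> adapted G M \<and> (\<forall>s\<ge>0. integrable P (M s)) \<and>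
     (\<forall>s u. 0 \<le> s \<and> s \<le> u \<longrightarrow> (AE w in P. real_cond_exp P (G s) (M u) w = M s w))"

text \<open>
  Stopping times take values in \<open>[0, \<infinity>]\<close>, hence not \<^const>\<open>stopping_time\<close>, where they have
  the type of the time parameter.
\<close>

definition ext_stopping_time :: "(real \<Rightarrow> 'w measure) \<Rightarrow> ('w \<Rightarrow> ennreal) \<Rightarrow> bool" where
  "ext_stopping_time G \<tau> \<longleftrightarrow> (\<forall>s\<ge>0. {w. \<tau> w \<le> ennreal s} \<in> sets (G s))"

definition stopped :: "(real \<Rightarrow> 'w \<Rightarrow> 'e) \<Rightarrow> ('w \<Rightarrow> ennreal) \<Rightarrow> real \<Rightarrow> 'w \<Rightarrow> 'e" where
  "stopped M \<tau> s w = M (enn2real (min (ennreal s) (\<tau> w))) w"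

text \<open>
  Path properties of processes are required almost surely: since the filtrations are not completed,
  a process cannot in general be modified on a null set and stay adapted.
\<close>

definition continuous_local_martingale ::
    "'w measure \<Rightarrow> (real \<Rightarrow> 'w measure) \<Rightarrow> (real \<Rightarrow> 'w \<Rightarrow> real) \<Rightarrow> bool" where
  "continuous_local_martingale P G M \<longleftrightarrow> adapted G M \<and>
     (AE w in P. continuous_on {0..} (\<lambda>s. M s w)) \<and>
     (\<exists>\<tau> :: nat \<Rightarrow> 'w \<Rightarrow> ennreal.
        (\<forall>n. ext_stopping_time G (\<tau> n)) \<and>
        (AE w in P. incseq (\<lambda>n. \<tau> n w) \<and> (\<lambda>n. \<tau> n w) \<longlonglongrightarrow> \<infinity>) \<and>
        (\<forall>n. martingale P G (stopped (\<lambda>s w. M s w - M 0 w) (\<tau> n))))"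

definition locally_bounded_variation :: "(real \<Rightarrow> 'e::real_normed_vector) \<Rightarrow> bool" where
  "locally_bounded_variation f \<longleftrightarrow> (\<forall>T\<ge>0. \<exists>K. \<forall>(p :: nat \<Rightarrow> real) n.
     mono p \<and> range p \<subseteq> {0..T} \<longrightarrow> (\<Sum>i<n. norm (f (p (Suc i)) - f (p i))) \<le> K)"

text \<open>
  Predictability, rather than adaptedness, of the finite variation processes is part of the
  definition of characteristics; it is automatic for adapted processes all of whose paths are
  continuous.
\<close>

definition continuous_fv_process ::
    "'w measure \<Rightarrow> (real \<Rightarrow> 'w measure) \<Rightarrow> (real \<Rightarrow> 'w \<Rightarrow> 'e::real_normed_vector) \<Rightarrow> bool" where
  "continuous_fv_process P G A \<longleftrightarrow> predictable G A \<and>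
     (AE w in P. A 0 w = 0 \<and> continuous_on {0..} (\<lambda>s. A s w) \<and>
        locally_bounded_variation (\<lambda>s. A s w))"

text \<open>\<open>Y = Y\<^sub>0 + M + B\<close>, with \<open>M\<close> a \<open>d\<close>-dimensional continuous local martingale.\<close>

definition fv_part ::
    "'w measure \<Rightarrow> (real \<Rightarrow> 'w measure) \<Rightarrow> (real \<Rightarrow> 'w \<Rightarrow> real ^ 'd::finite) \<Rightarrow>
     (real \<Rightarrow> 'w \<Rightarrow> real ^ 'd) \<Rightarrow> bool" where
  "fv_part P G Y B \<longleftrightarrow> continuous_fv_process P G B \<and>
     (\<forall>i. continuous_local_martingale P G (\<lambda>s w. (Y s w - Y 0 w - B s w) $ i))"

definition continuous_semimartingale ::
    "'w measure \<Rightarrow> (real \<Rightarrow> 'w measure) \<Rightarrow> (real \<Rightarrow> 'w \<Rightarrow> real ^ 'd::finite) \<Rightarrow> bool" where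
  "continuous_semimartingale P G Y \<longleftrightarrow> adapted G Y \<and>
     (AE w in P. continuous_on {0..} (\<lambda>s. Y s w)) \<and> (\<exists>B. fv_part P G Y B)"

text \<open>
  \<open>C\<close> is the quadratic variation of a continuous local martingale \<open>M\<close> with \<open>M\<^sub>0 = 0\<close>: the continuous
  finite variation process null at zero for which all \<open>M\<^sup>i M\<^sup>j - C\<^sup>i\<^sup>j\<close> are local martingales.
\<close>

definition quadratic_variation ::
    "'w measure \<Rightarrow> (real \<Rightarrow> 'w measure) \<Rightarrow> (real \<Rightarrow> 'w \<Rightarrow> real ^ 'd::finite) \<Rightarrow>
     (real \<Rightarrow> 'w \<Rightarrow> real ^ 'd ^ 'd) \<Rightarrow> bool" where
  "quadratic_variation P G M C \<longleftrightarrow> continuous_fv_process P G C \<and>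
     (\<forall>i j. continuous_local_martingale P G (\<lambda>s w. M s w $ i * M s w $ j - C s w $ i $ j))"

text \<open>
  Characteristics are unique only up to indistinguishability, hence the relational definition.
\<close>

definition characteristics ::
    "'w measure \<Rightarrow> (real \<Rightarrow> 'w measure) \<Rightarrow> (real \<Rightarrow> 'w \<Rightarrow> real ^ 'd::finite) \<Rightarrow>
     (real \<Rightarrow> 'w \<Rightarrow> real ^ 'd) \<Rightarrow> (real \<Rightarrow> 'w \<Rightarrow> real ^ 'd ^ 'd) \<Rightarrow> bool" where
  "characteristics P G Y B C \<longleftrightarrow> continuous_semimartingale P G Y \<and> fv_part P G Y B \<and>
     quadratic_variation P G (\<lambda>s w. Y s w - Y 0 w - B s w) C"

definition has_density :: "(real \<Rightarrow> 'e::euclidean_space) \<Rightarrow> (real \<Rightarrow> 'e) \<Rightarrow> bool" where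
  "has_density f g \<longleftrightarrow> (\<forall>s\<ge>0. set_integrable lborel {0..s} g \<and>
     f s = f 0 + (LINT u:{0..s}|lborel. g u))"

definition locally_abs_continuous :: "(real \<Rightarrow> 'e::euclidean_space) \<Rightarrow> bool" where
  "locally_abs_continuous f \<longleftrightarrow> (\<exists>g. has_density f g)"

abbreviation lebesgue_halfline :: "real measure" where
  "lebesgue_halfline \<equiv> restrict_space lborel {0..}"

text \<open>Jointly measurable; thus unique up to null sets of the product of Lebesgue measure and \<open>P\<close>.\<close>

definition density_process ::
    "'w measure \<Rightarrow> (real \<Rightarrow> 'w \<Rightarrow> 'e::euclidean_space) \<Rightarrow> (real \<Rightarrow> 'w \<Rightarrow> 'e) \<Rightarrow> bool" where
  "density_process P A \<alpha> \<longleftrightarrow>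
     (\<lambda>(s, w). \<alpha> s w) \<in> borel_measurable (lebesgue_halfline \<Otimes>\<^sub>M P) \<and>
     (AE w in P. has_density (\<lambda>s. A s w) (\<lambda>s. \<alpha> s w))"


section \<open>Semimartingale laws on path space\<close>

definition path_measures :: "'d::finite cpath measure set" where
  "path_measures = {P. prob_space P \<and> sets P = sets borel}"

definition X :: "real \<Rightarrow> 'd::finite cpath \<Rightarrow> real ^ 'd" where
  "X t w = path_at w t"

definition shifted_X :: "real \<Rightarrow> real \<Rightarrow> 'd::finite cpath \<Rightarrow> real ^ 'd" where
  "shifted_X t s w = X (s + t) w"

definition shifted_filtration :: "real \<Rightarrow> real \<Rightarrow> 'd::finite cpath measure" where
  "shifted_filtration t = right_cont_filtration (natural_filtration (shifted_X t))"

definition path_characteristics ::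
    "real \<Rightarrow> 'd::finite cpath measure \<Rightarrow> (real \<Rightarrow> 'd cpath \<Rightarrow> real ^ 'd) \<Rightarrow>
     (real \<Rightarrow> 'd cpath \<Rightarrow> real ^ 'd ^ 'd) \<Rightarrow> bool" where
  "path_characteristics t P B C \<longleftrightarrow>
     characteristics P (shifted_filtration t) (shifted_X t) B C"

definition P_sem :: "real \<Rightarrow> 'd::finite cpath measure set" where
  "P_sem t = {P \<in> path_measures.
     continuous_semimartingale P (shifted_filtration t) (shifted_X t)}"

definition P_sem_ac :: "real \<Rightarrow> 'd::finite cpath measure set" where
  "P_sem_ac t = {P \<in> P_sem t. \<exists>B C. path_characteristics t P B C \<and>
     (AE w in P. locally_abs_continuous (\<lambda>s. B s w) \<and> locally_abs_continuous (\<lambda>s. C s w))}"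


section \<open>Control sets\<close>

definition psd_matrices :: "(real ^ 'd ^ 'd::finite) set" where
  "psd_matrices = {A. transpose A = A \<and> (\<forall>x. 0 \<le> x \<bullet> (A *v x))}"

definition \<Theta> ::
    "('f \<Rightarrow> real \<Rightarrow> 'd::finite cpath \<Rightarrow> real ^ 'd) \<Rightarrow> ('f \<Rightarrow> real \<Rightarrow> 'd cpath \<Rightarrow> real ^ 'd ^ 'd) \<Rightarrow>
     real \<Rightarrow> 'd cpath \<Rightarrow> ((real ^ 'd) \<times> (real ^ 'd ^ 'd)) set" where
  "\<Theta> b a t w = {(b f t w, a f t w) | f. True}"

text \<open>
  In the following two definitions the choice of characteristics and densities is immaterial,
  by their uniqueness up to null sets.
\<close>

definition law_C ::
    "('f \<Rightarrow> real \<Rightarrow> 'd::finite cpath \<Rightarrow> real ^ 'd) \<Rightarrow> ('f \<Rightarrow> real \<Rightarrow> 'd cpath \<Rightarrow> real ^ 'd ^ 'd) \<Rightarrow>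
     real \<Rightarrow> 'd cpath \<Rightarrow> 'd cpath measure set" where
  "law_C b a t \<omega> = {P \<in> P_sem_ac t.
     measure P {w. stop_path t w = stop_path t \<omega>} = 1 \<and>
     (\<exists>B C \<beta> \<alpha>. path_characteristics t P B C \<and> density_process P B \<beta> \<and> density_process P C \<alpha> \<and>
        (AE (s, w) in lebesgue_halfline \<Otimes>\<^sub>M P.
           (\<beta> s w, \<alpha> s w) \<in> \<Theta> b a (s + t) (concat_path t \<omega> w)))}"

definition law_R ::
    "('f \<Rightarrow> real \<Rightarrow> 'd::finite cpath \<Rightarrow> real ^ 'd) \<Rightarrow> ('f \<Rightarrow> real \<Rightarrow> 'd cpath \<Rightarrow> real ^ 'd ^ 'd) \<Rightarrow>
     real \<Rightarrow> 'd cpath \<Rightarrow> 'd cpath measure set" where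
  "law_R b a t \<omega> = {P \<in> P_sem_ac 0.
     distr P borel (X 0) = return borel (X t \<omega>) \<and>
     (\<exists>B C \<beta> \<alpha>. path_characteristics 0 P B C \<and> density_process P B \<beta> \<and> density_process P C \<alpha> \<and>
        (AE (s, w) in lebesgue_halfline \<Otimes>\<^sub>M P.
           (\<beta> s w, \<alpha> s w) \<in> \<Theta> b a (s + t) (concat_shift t \<omega> w)))}"


section \<open>Upper semianalytic functions and their expectations\<close>

text \<open>Analytic subsets of a Polish space are the continuous images of Baire space, and the empty set.\<close>

definition analytic_set :: "'a::topological_space set \<Rightarrow> bool" where
  "analytic_set A \<longleftrightarrow> A = {} \<or>
     (\<exists>f :: (nat \<Rightarrow> nat) \<Rightarrow> 'a. continuous_on UNIV f \<and> range f = A)"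

definition upper_semianalytic :: "('a::topological_space \<Rightarrow> real) \<Rightarrow> bool" where
  "upper_semianalytic \<psi> \<longleftrightarrow> (\<forall>c. analytic_set {x. \<psi> x > c})"

text \<open>The case distinction is needed because \<open>\<infinity> - \<infinity> = \<infinity>\<close> in \<^typ>\<open>ereal\<close>.\<close>

definition completed_expectation :: "'a measure \<Rightarrow> ('a \<Rightarrow> real) \<Rightarrow> ereal" where
  "completed_expectation P \<xi> =
     (let p = \<integral>\<^sup>+ x. ennreal (\<xi> x) \<partial>completion P; n = \<integral>\<^sup>+ x. ennreal (- \<xi> x) \<partial>completion P
      in if p = \<infinity> \<and> n = \<infinity> then - \<infinity> else enn2ereal p - enn2ereal n)"

end

theory Submission
  imports Defs
begin

text \<open>
  Both suprema run over the same laws, seen on two clocks. Let \<open>\<theta> = shift_path t\<close> forget the past before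
  time \<open>t\<close> and restart the clock, and let \<open>\<sigma> = prepend_path t \<omega>\<close> put a vertically translated copy of
  \<open>\<omega>\<close> restricted to \<open>[0, t]\<close> in front of a path. The translation makes the result continuous for every
  starting point, so that \<open>\<theta> \<circ> \<sigma>\<close> is the identity everywhere; and \<open>\<sigma> \<circ> \<theta>\<close> is the identity on
  the paths that agree with \<open>\<omega>\<close> up to time \<open>t\<close>, which carry every law in \<open>law_C b a t \<omega>\<close>. Pushing laws
  forward along \<open>\<sigma>\<close> is therefore a bijection from \<open>law_R b a t \<omega>\<close> onto \<open>law_C b a t \<omega>\<close>, with inverse
  the push-forward along \<open>\<theta>\<close>, as soon as it is known to respect the two defining conditions
  (\<open>law_C_eq_image\<close>).

  The semimartingale condition is where the work lies. The filtration of \<open>X\<close> after time \<open>t\<close> consists of the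
  preimages under \<open>\<theta>\<close> of the filtration of \<open>X\<close>, also after passing to right limits because \<open>\<theta>\<close> is
  surjective; since \<open>\<theta> \<circ> \<sigma>\<close> is the identity, the latter filtration conversely consists of the preimages
  under \<open>\<sigma>\<close> of the former. So \<open>\<theta>\<close> and \<open>\<sigma>\<close> are both factor maps of filtered probability spaces, and
  one general principle serves both directions: composition with a factor map preserves martingales,
  hence characteristics and their densities (\<open>characteristics_pullback\<close>, \<open>density_process_pullback\<close>). The
  coefficient sets match because \<open>\<omega> \<otimes>\<^sub>t w\<close> depends on \<open>w\<close> only through \<open>\<theta> w\<close>.

  Finally, the two expectations of \<open>\<psi>\<close> agree law by law. As the maps are inverse to each other up to null
  sets, the change of variables holds for the lower integral of an arbitrary function
  (\<open>nn_integral_distr_invertible\<close>), and the integrals in \<^const>\<open>completed_expectation\<close> are lower integrals,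
  for which completing the measure makes no difference.
\<close>

section \<open>Factor maps of filtered probability spaces\<close>

text \<open>
  \<open>H\<close> is exactly the filtration generated by \<open>T\<close> from \<open>G\<close>. Mere measurability of \<open>T\<close> from \<open>H s\<close>
  to \<open>G s\<close> would not suffice: conditioning on a larger sigma-algebra may destroy martingales.
\<close>

locale filtered_factor =
  fixes P :: "'w measure" and Q :: "'v measure"
    and H :: "real \<Rightarrow> 'w measure" and G :: "real \<Rightarrow> 'v measure" and T :: "'w \<Rightarrow> 'v"
  assumes prob_P: "prob_space P"
    and space_P: "space P = UNIV" and space_Q: "space Q = UNIV"
    and T_measurable: "T \<in> measurable P Q" and distr_T: "distr P Q T = Q"
    and subalgebra_H: "0 \<le> s \<Longrightarrow> subalgebra P (H s)"
    and subalgebra_G: "0 \<le> s \<Longrightarrow> subalgebra Q (G s)"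
    and sets_H: "0 \<le> s \<Longrightarrow> sets (H s) = {T -` A | A. A \<in> sets (G s)}"
begin

lemma prob_Q: "prob_space Q"
  using prob_space.prob_space_distr[OF prob_P T_measurable] distr_T by simp

lemma AE_pullback: "AE v in Q. p v \<Longrightarrow> AE w in P. p (T w)"
  using AE_distrD[OF T_measurable, of p] unfolding distr_T .

lemma T_measurable_filtration:
  assumes "0 \<le> s" shows "T \<in> measurable (H s) (G s)"
proof (rule measurableI)
  show "T w \<in> space (G s)" for w
    using subalgebra_G[OF assms] space_Q by (simp add: subalgebra_def)
  show "T -` A \<inter> space (H s) \<in> sets (H s)" if "A \<in> sets (G s)" for A
    using that subalgebra_H[OF assms] space_P sets_H[OF assms] by (auto simp: subalgebra_def)
qed

lemma integrable_pullback:
  fixes f :: "'v \<Rightarrow> 'b::{banach, second_countable_topology}"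
  shows "integrable Q f \<Longrightarrow> integrable P (\<lambda>w. f (T w))"
  using integrable_distr[OF T_measurable, of f] by (simp add: distr_T)

lemma integral_pullback:
  fixes f :: "'v \<Rightarrow> 'b::{banach, second_countable_topology}"
  assumes "f \<in> borel_measurable Q"
  shows "(LINT w|P. f (T w)) = (LINT v|Q. f v)"
  using integral_distr[OF T_measurable assms] by (simp add: distr_T)

text \<open>
  The pulled back process is here a process \<open>Y'\<close> that agrees with \<open>Y\<close> along \<open>T\<close> at nonnegative times,
  since the processes to which this is applied may differ at negative ones.
\<close>

lemma adapted_pullback:
  assumes "adapted G Y" "\<And>s w. 0 \<le> s \<Longrightarrow> Y' s w = Y s (T w)"
  shows "adapted H Y'"
  unfolding adapted_def
proof (intro allI impI)
  fix s :: real assume s: "0 \<le> s"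
  have "(\<lambda>w. Y s (T w)) \<in> borel_measurable (H s)"
    using assms(1) s measurable_compose[OF T_measurable_filtration] by (auto simp: adapted_def)
  moreover have "Y' s = (\<lambda>w. Y s (T w))" using assms(2)[OF s] by blast
  ultimately show "Y' s \<in> borel_measurable (H s)" by simp
qed

text \<open>Composition with \<open>T\<close> preserves the left-continuous adapted processes that generate predictability.\<close>

lemma predictable_pullback:
  assumes "predictable G Y"
  shows "predictable H (\<lambda>s w. Y s (T w))"
proof -
  have "(\<lambda>(s, w). (s, T w)) \<in> measurable (predictable_sigma H) (predictable_sigma G)"
    unfolding predictable_sigma_def[of G]
  proof (rule measurable_sigma_sets[OF sets_measure_of])
    have space_H: "space (predictable_sigma H) = {0..} \<times> UNIV"
      unfolding predictable_sigma_def by (rule space_measure_of) auto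
    show "(\<lambda>(s, w). (s, T w)) \<in> space (predictable_sigma H) \<rightarrow> {0..} \<times> UNIV"
      by (auto simp: space_H)
    fix E assume "E \<in> {{(s, w). 0 \<le> s \<and> Y s w \<in> A} | (Y :: real \<Rightarrow> 'v \<Rightarrow> real) A.
        adapted G Y \<and> (\<forall>w. \<forall>s>0. continuous (at_left s) (\<lambda>u. Y u w)) \<and> A \<in> sets borel}"
    then obtain Y :: "real \<Rightarrow> 'v \<Rightarrow> real" and A where E: "E = {(s, w). 0 \<le> s \<and> Y s w \<in> A}"
      and Y: "adapted G Y" "\<And>w s. 0 < s \<Longrightarrow> continuous (at_left s) (\<lambda>u. Y u w)" "A \<in> sets borel"
      by blast
    have "{(s, w). 0 \<le> s \<and> Y s (T w) \<in> A} \<in> sets (predictable_sigma H)"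
      unfolding predictable_sigma_def
    proof (rule in_measure_of)
      have "adapted H (\<lambda>s w. Y s (T w))" by (rule adapted_pullback[OF Y(1)]) simp
      then show "{(s, w). 0 \<le> s \<and> Y s (T w) \<in> A} \<in> {{(s, w). 0 \<le> s \<and> Y s w \<in> A} |
          (Y :: real \<Rightarrow> 'w \<Rightarrow> real) A. adapted H Y \<and>
          (\<forall>w. \<forall>s>0. continuous (at_left s) (\<lambda>u. Y u w)) \<and> A \<in> sets borel}"
        using Y(2,3) by (intro CollectI exI[of _ "\<lambda>s w. Y s (T w)"] exI[of _ A]) simp
    qed auto
    moreover have "(\<lambda>(s, w). (s, T w)) -` E \<inter> space (predictable_sigma H) =
        {(s, w). 0 \<le> s \<and> Y s (T w) \<in> A}"
      by (auto simp: E space_H)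
    ultimately show "(\<lambda>(s, w). (s, T w)) -` E \<inter> space (predictable_sigma H)
        \<in> sets (predictable_sigma H)" by simp
  qed auto
  from measurable_compose[OF this assms[unfolded predictable_def]]
  show ?thesis by (simp add: predictable_def case_prod_beta')
qed

text \<open>
  Every event of \<open>H s\<close> has the form \<open>T -` D\<close> with \<open>D\<close> in \<open>G s\<close>, and integrals over it are
  integrals over \<open>D\<close> under \<open>Q\<close>; so the averages that characterise conditional expectations agree.
\<close>

lemma martingale_pullback:
  assumes "martingale Q G M" "\<And>s w. 0 \<le> s \<Longrightarrow> M' s w = M s (T w)"
  shows "martingale P H M'"
  unfolding martingale_def
proof (intro conjI allI impI)
  have M: "adapted G M" "\<And>s. 0 \<le> s \<Longrightarrow> integrable Q (M s)"
    "\<And>s u. 0 \<le> s \<Longrightarrow> s \<le> u \<Longrightarrow> AE w in Q. real_cond_exp Q (G s) (M u) w = M s w"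
    using assms(1) by (auto simp: martingale_def)
  have M': "M' s = (\<lambda>w. M s (T w))" if "0 \<le> s" for s using assms(2)[OF that] by blast
  show adapted': "adapted H M'" by (rule adapted_pullback) fact+
  show int': "integrable P (M' s)" if "0 \<le> s" for s
    using integrable_pullback[OF M(2)[OF that]] by (simp add: M'[OF that])
  show "AE w in P. real_cond_exp P (H s) (M' u) w = M' s w" if su: "0 \<le> s \<and> s \<le> u" for s u
  proof -
    have s: "0 \<le> s" and u: "0 \<le> u" using su by auto
    interpret P: prob_space P by (rule prob_P)
    interpret Q: prob_space Q by (rule prob_Q)
    interpret PH: finite_measure_subalgebra P "H s"
      by unfold_locales (rule subalgebra_H[OF s])
    interpret QG: finite_measure_subalgebra Q "G s"
      by unfold_locales (rule subalgebra_G[OF s])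
    show ?thesis
    proof (rule PH.real_cond_exp_charact)
      show "M' s \<in> borel_measurable (H s)" using adapted' s by (simp add: adapted_def)
      show "integrable P (M' u)" "integrable P (M' s)" by (rule int'; fact)+
      fix A assume "A \<in> sets (H s)"
      then obtain D where D: "A = T -` D" "D \<in> sets (G s)" using sets_H[OF s] by auto
      have DQ: "D \<in> sets Q" using D(2) subalgebra_G[OF s] by (auto simp: subalgebra_def)
      have set_int: "(LINT w:A|P. M' r w) = (LINT v:D|Q. M r v)" if "0 \<le> r" for r
      proof -
        have "(LINT w:A|P. M' r w) = (LINT w|P. indicator D (T w) *\<^sub>R M r (T w))"
          by (simp add: set_lebesgue_integral_def M'[OF that] D(1) indicator_def)
        also have "\<dots> = (LINT v|Q. indicator D v *\<^sub>R M r v)"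
          using M(2)[OF that] DQ
          by (intro integral_pullback) (auto dest: borel_measurable_integrable)
        finally show ?thesis by (simp add: set_lebesgue_integral_def)
      qed
      have "(LINT v:D|Q. M u v) = (LINT v:D|Q. real_cond_exp Q (G s) (M u) v)"
        by (rule QG.real_cond_exp_intA[OF M(2)[OF u] D(2)])
      also have "\<dots> = (LINT v:D|Q. M s v)"
        unfolding set_lebesgue_integral_def
        by (rule integral_cong_AE)
           (use M(3)[of s u] su DQ M(2)[OF s] in \<open>auto dest: borel_measurable_integrable\<close>)
      finally show "(LINT w:A|P. M' u w) = (LINT w:A|P. M' s w)"
        by (simp add: set_int s u)
    qed
  qed
qed

lemma ext_stopping_time_pullback:
  assumes "ext_stopping_time G \<tau>" shows "ext_stopping_time H (\<lambda>w. \<tau> (T w))"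
  unfolding ext_stopping_time_def
proof (intro allI impI)
  fix s :: real assume s: "0 \<le> s"
  have "{v. \<tau> v \<le> ennreal s} \<in> sets (G s)" using assms s by (simp add: ext_stopping_time_def)
  moreover have "{w. \<tau> (T w) \<le> ennreal s} = T -` {v. \<tau> v \<le> ennreal s}" by auto
  ultimately show "{w. \<tau> (T w) \<le> ennreal s} \<in> sets (H s)" using sets_H[OF s] by blast
qed

lemma continuous_local_martingale_pullback:
  assumes "continuous_local_martingale Q G M" and M': "\<And>s w. 0 \<le> s \<Longrightarrow> M' s w = M s (T w)"
  shows "continuous_local_martingale P H M'"
proof -
  obtain \<tau> where M: "adapted G M" "AE v in Q. continuous_on {0..} (\<lambda>s. M s v)"
    and \<tau>: "\<And>n. ext_stopping_time G (\<tau> n)"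
      "AE v in Q. incseq (\<lambda>n. \<tau> n v) \<and> (\<lambda>n. \<tau> n v) \<longlonglongrightarrow> \<infinity>"
      "\<And>n. martingale Q G (stopped (\<lambda>s v. M s v - M 0 v) (\<tau> n))"
    using assms(1) unfolding continuous_local_martingale_def by auto
  have "AE w in P. continuous_on {0..} (\<lambda>s. M' s w)"
    using AE_pullback[OF M(2)] by (simp add: M' cong: continuous_on_cong_simp)
  moreover have "martingale P H (stopped (\<lambda>s w. M' s w - M' 0 w) (\<lambda>w. \<tau> n (T w)))" for n
    by (rule martingale_pullback[OF \<tau>(3)[of n]]) (simp add: stopped_def M')
  ultimately show ?thesis
    unfolding continuous_local_martingale_def
    using adapted_pullback[OF M(1) M'] ext_stopping_time_pullback[OF \<tau>(1)] AE_pullback[OF \<tau>(2)]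
    by (intro conjI exI[of _ "\<lambda>n w. \<tau> n (T w)"]) auto
qed

lemma continuous_fv_process_pullback:
  "continuous_fv_process Q G A \<Longrightarrow> continuous_fv_process P H (\<lambda>s w. A s (T w))"
  using AE_pullback[of "\<lambda>v. A 0 v = 0 \<and> continuous_on {0..} (\<lambda>s. A s v) \<and>
    locally_bounded_variation (\<lambda>s. A s v)"]
  by (simp add: continuous_fv_process_def predictable_pullback)

lemma fv_part_pullback:
  assumes "fv_part Q G Y B" "\<And>s w. 0 \<le> s \<Longrightarrow> Y' s w = Y s (T w)"
  shows "fv_part P H Y' (\<lambda>s w. B s (T w))"
  unfolding fv_part_def
proof (intro conjI allI)
  show "continuous_fv_process P H (\<lambda>s w. B s (T w))"
    using assms(1) by (simp add: fv_part_def continuous_fv_process_pullback)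
  have "continuous_local_martingale Q G (\<lambda>s v. (Y s v - Y 0 v - B s v) $ i)" for i
    using assms(1) by (simp add: fv_part_def)
  then show "continuous_local_martingale P H (\<lambda>s w. (Y' s w - Y' 0 w - B s (T w)) $ i)" for i
    by (rule continuous_local_martingale_pullback) (simp add: assms(2))
qed

lemma continuous_semimartingale_pullback:
  assumes "continuous_semimartingale Q G Y" and Y': "\<And>s w. 0 \<le> s \<Longrightarrow> Y' s w = Y s (T w)"
  shows "continuous_semimartingale P H Y'"
proof -
  obtain B where Y: "adapted G Y" "AE v in Q. continuous_on {0..} (\<lambda>s. Y s v)" "fv_part Q G Y B"
    using assms(1) unfolding continuous_semimartingale_def by blast
  have "AE w in P. continuous_on {0..} (\<lambda>s. Y' s w)"
    using AE_pullback[OF Y(2)] by (simp add: Y' cong: continuous_on_cong_simp)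
  then show ?thesis
    using adapted_pullback[OF Y(1) Y'] fv_part_pullback[OF Y(3) Y']
    unfolding continuous_semimartingale_def by blast
qed

lemma characteristics_pullback:
  assumes "characteristics Q G Y B C" and Y': "\<And>s w. 0 \<le> s \<Longrightarrow> Y' s w = Y s (T w)"
  shows "characteristics P H Y' (\<lambda>s w. B s (T w)) (\<lambda>s w. C s (T w))"
proof -
  have "quadratic_variation P H (\<lambda>s w. Y' s w - Y' 0 w - B s (T w)) (\<lambda>s w. C s (T w))"
    unfolding quadratic_variation_def
  proof (intro conjI allI)
    show "continuous_fv_process P H (\<lambda>s w. C s (T w))"
      using assms(1)
      by (simp add: characteristics_def quadratic_variation_def continuous_fv_process_pullback)
    fix i j
    have "continuous_local_martingale Q G
        (\<lambda>s v. (Y s v - Y 0 v - B s v) $ i * (Y s v - Y 0 v - B s v) $ j - C s v $ i $ j)"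
      using assms(1) by (simp add: characteristics_def quadratic_variation_def)
    then show "continuous_local_martingale P H (\<lambda>s w. (Y' s w - Y' 0 w - B s (T w)) $ i *
        (Y' s w - Y' 0 w - B s (T w)) $ j - C s (T w) $ i $ j)"
      by (rule continuous_local_martingale_pullback) (simp add: Y')
  qed
  then show ?thesis
    using assms(1) continuous_semimartingale_pullback[where Y = Y and Y' = Y', OF _ Y']
      fv_part_pullback[where Y = Y and Y' = Y', OF _ Y']
    unfolding characteristics_def by blast
qed

lemma map_snd_measurable:
  "(\<lambda>(s, w). (s, T w)) \<in> measurable (lebesgue_halfline \<Otimes>\<^sub>M P) (lebesgue_halfline \<Otimes>\<^sub>M Q)"
  using T_measurable by measurable

lemma density_process_pullback:
  assumes "density_process Q A \<alpha>"
  shows "density_process P (\<lambda>s w. A s (T w)) (\<lambda>s w. \<alpha> s (T w))"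
  using assms AE_pullback[of "\<lambda>v. has_density (\<lambda>s. A s v) (\<lambda>s. \<alpha> s v)"]
    measurable_compose[OF map_snd_measurable, of "\<lambda>(s, v). \<alpha> s v"]
  by (auto simp: density_process_def case_prod_beta')

text \<open>The map \<open>(s, w) \<mapsto> (s, T w)\<close> transports one product measure to the other.\<close>

lemma AE_halfline_pullback:
  assumes "AE (s, v) in lebesgue_halfline \<Otimes>\<^sub>M Q. p s v"
  shows "AE (s, w) in lebesgue_halfline \<Otimes>\<^sub>M P. p s (T w)"
proof -
  interpret Q: prob_space Q by (rule prob_Q)
  have "lebesgue_halfline \<Otimes>\<^sub>M Q =
      distr lebesgue_halfline lebesgue_halfline (\<lambda>s. s) \<Otimes>\<^sub>M distr P Q T"
    by (simp add: distr_T)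
  also have "\<dots> = distr (lebesgue_halfline \<Otimes>\<^sub>M P) (lebesgue_halfline \<Otimes>\<^sub>M Q) (\<lambda>(s, w). (s, T w))"
    by (rule pair_measure_distr) (auto simp: T_measurable distr_T Q.sigma_finite_measure_axioms)
  finally have "AE (s, v) in distr (lebesgue_halfline \<Otimes>\<^sub>M P) (lebesgue_halfline \<Otimes>\<^sub>M Q)
      (\<lambda>(s, w). (s, T w)). p s v"
    using assms by (rule subst)
  from AE_distrD[OF map_snd_measurable this] show ?thesis by (simp add: case_prod_beta')
qed

end

section \<open>Integrals of nonmeasurable functions\<close>

text \<open>
  The integral of a nonmeasurable function is the supremum over the simple functions below it. Composition
  with \<open>T\<close> turns simple functions below \<open>f\<close> into simple functions below \<open>f \<circ> T\<close>, but there may be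
  further ones that do not factor through \<open>T\<close>.
\<close>

lemma nn_integral_distr_le:
  assumes T: "T \<in> measurable M N"
  shows "integral\<^sup>N (distr M N T) f \<le> (\<integral>\<^sup>+ x. f (T x) \<partial>M)"
  unfolding nn_integral_def[of "distr M N T"]
proof (rule SUP_least)
  fix g assume g: "g \<in> {g. simple_function (distr M N T) g \<and> g \<le> f}"
  then have "integral\<^sup>S (distr M N T) g = integral\<^sup>N (distr M N T) g"
    by (simp add: nn_integral_eq_simple_integral)
  also have "\<dots> = (\<integral>\<^sup>+ x. g (T x) \<partial>M)"
    using g by (intro nn_integral_distr T) (auto dest: borel_measurable_simple_function)
  also have "\<dots> \<le> (\<integral>\<^sup>+ x. f (T x) \<partial>M)"
    using g by (intro nn_integral_mono) (auto simp: le_fun_def)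
  finally show "integral\<^sup>S (distr M N T) g \<le> (\<integral>\<^sup>+ x. f (T x) \<partial>M)" .
qed

text \<open>The reverse inequality is the same comparison for \<open>S\<close>, which carries the image measure back to \<open>M\<close>.\<close>

lemma nn_integral_distr_invertible:
  assumes T: "T \<in> measurable M N" and S: "S \<in> measurable N M"
    and ST: "\<And>x. x \<in> space M \<Longrightarrow> S (T x) = x"
    and TS: "AE y in distr M N T. T (S y) = y"
  shows "integral\<^sup>N (distr M N T) f = (\<integral>\<^sup>+ x. f (T x) \<partial>M)"
proof (rule antisym[OF nn_integral_distr_le[OF T]])
  have "distr (distr M N T) M S = distr M M (\<lambda>x. x)"
    unfolding distr_distr[OF S T] by (rule distr_cong) (simp_all add: ST)
  then have "(\<integral>\<^sup>+ x. f (T x) \<partial>M) = (\<integral>\<^sup>+ x. f (T x) \<partial>distr (distr M N T) M S)"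
    by simp
  also have "\<dots> \<le> (\<integral>\<^sup>+ y. f (T (S y)) \<partial>distr M N T)"
    using S by (intro nn_integral_distr_le) simp
  also have "\<dots> = integral\<^sup>N (distr M N T) f"
    by (rule nn_integral_cong_AE) (use TS in auto)
  finally show "(\<integral>\<^sup>+ x. f (T x) \<partial>M) \<le> integral\<^sup>N (distr M N T) f" .
qed

section \<open>The path shift and its sections\<close>

text \<open>The positive part makes this a path for negative \<open>t\<close> as well.\<close>

lift_definition shift_path :: "real \<Rightarrow> 'd::finite cpath \<Rightarrow> 'd cpath" is
  "\<lambda>t w. restrict (\<lambda>s. w (s + max 0 t)) {0..}"
proof -
  fix t :: real and w :: "real \<Rightarrow> real ^ 'd"
  assume w: "continuous_on {0..} w \<and> w \<in> extensional {0..}"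
  have "continuous_on {0..} (\<lambda>s. w (s + max 0 t))"
    by (rule continuous_on_compose2[OF w[THEN conjunct1]]) (auto intro!: continuous_intros)
  then show "continuous_on {0..} (restrict (\<lambda>s. w (s + max 0 t)) {0..}) \<and>
      restrict (\<lambda>s. w (s + max 0 t)) {0..} \<in> extensional {0..}"
    by (rule restrict_continuous_extensional)
qed

text \<open>
  In contrast to \<^const>\<open>concat_shift\<close>, which translates the new path to the end point of the old one, the old
  path is translated to the starting point of the new one. So the shift recovers \<open>v\<close> itself and not
  merely its increments.
\<close>

lift_definition prepend_path :: "real \<Rightarrow> 'd::finite cpath \<Rightarrow> 'd cpath \<Rightarrow> 'd cpath" is
  "\<lambda>t w v. restrict (\<lambda>s. if s < t then w s + v 0 - w t else v (s - t)) {0..}"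
proof -
  fix t :: real and w v :: "real \<Rightarrow> real ^ 'd"
  assume w: "continuous_on {0..} w \<and> w \<in> extensional {0..}"
    and v: "continuous_on {0..} v \<and> v \<in> extensional {0..}"
  have "continuous_on {0..} (\<lambda>s. if s < t then w s + v 0 - w t else v (s - t))"
  proof (rule continuous_on_splice)
    have "continuous_on {0..t} w" by (rule continuous_on_subset[of "{0..}"]) (use w in auto)
    then show "continuous_on {0..t} (\<lambda>s. w s + v 0 - w t)" by (intro continuous_intros)
    show "continuous_on {max 0 t..} (\<lambda>s. v (s - t))"
      by (rule continuous_on_compose2[OF v[THEN conjunct1]]) (auto intro!: continuous_intros)
  qed simp
  then show "continuous_on {0..} (restrict (\<lambda>s. if s < t then w s + v 0 - w t else v (s - t)) {0..}) \<and>
      restrict (\<lambda>s. if s < t then w s + v 0 - w t else v (s - t)) {0..} \<in> extensional {0..}"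
    by (rule restrict_continuous_extensional)
qed

lemma cpath_eqI: "(\<And>s. 0 \<le> s \<Longrightarrow> path_at v s = path_at w s) \<Longrightarrow> v = w"
proof -
  assume eq: "\<And>s. 0 \<le> s \<Longrightarrow> path_at v s = path_at w s"
  have "path_at v = path_at w"
    by (rule extensionalityI[of _ "{0..}"]) (use path_at[of v] path_at[of w] eq in auto)
  then show "v = w" by (simp add: path_at_inject)
qed

lemma path_at_shift: "0 \<le> t \<Longrightarrow> 0 \<le> s \<Longrightarrow> path_at (shift_path t w) s = path_at w (s + t)"
  by transfer simp

lemma path_at_prepend:
  "0 \<le> s \<Longrightarrow> path_at (prepend_path t w v) s =
     (if s < t then path_at w s + path_at v 0 - path_at w t else path_at v (s - t))"
  by transfer simp

lemma path_at_concat_shift: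
  "0 \<le> s \<Longrightarrow> path_at (concat_shift t w v) s =
     (if s < t then path_at w s else path_at w t + path_at v (s - t) - path_at v 0)"
  by transfer simp

lemma path_at_concat:
  "0 \<le> s \<Longrightarrow> path_at (concat_path t w v) s =
     (if s < t then path_at w s else path_at w t + path_at v s - path_at v t)"
  by transfer simp

lemma path_at_stop: "0 \<le> s \<Longrightarrow> path_at (stop_path t w) s = path_at w (min s t)"
  by transfer simp

lemma stop_path_eq_iff:
  assumes "0 \<le> t"
  shows "stop_path t v = stop_path t w \<longleftrightarrow> (\<forall>s\<in>{0..t}. path_at v s = path_at w s)"
proof
  assume "stop_path t v = stop_path t w"
  then show "\<forall>s\<in>{0..t}. path_at v s = path_at w s"
    by (metis atLeastAtMost_iff min.absorb1 path_at_stop)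
next
  assume "\<forall>s\<in>{0..t}. path_at v s = path_at w s"
  then show "stop_path t v = stop_path t w" using assms by (intro cpath_eqI) (auto simp: path_at_stop)
qed

lemma shift_prepend: "0 \<le> t \<Longrightarrow> shift_path t (prepend_path t \<omega> v) = v"
  by (rule cpath_eqI) (simp add: path_at_shift path_at_prepend)

lemma prepend_shift:
  assumes "0 \<le> t" "stop_path t w = stop_path t \<omega>"
  shows "prepend_path t \<omega> (shift_path t w) = w"
  using assms by (intro cpath_eqI) (simp add: path_at_shift path_at_prepend stop_path_eq_iff)

lemma concat_shift_shift: "0 \<le> t \<Longrightarrow> concat_shift t \<omega> (shift_path t w) = concat_path t \<omega> w"
  by (rule cpath_eqI) (simp add: path_at_shift path_at_concat_shift path_at_concat)

lemma concat_path_prepend: "0 \<le> t \<Longrightarrow> concat_path t \<omega> (prepend_path t \<omega> v) = concat_shift t \<omega> v"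
  by (metis concat_shift_shift shift_prepend)

lemma prepend_eq_concat_shift:
  "path_at v 0 = path_at \<omega> t \<Longrightarrow> prepend_path t \<omega> v = concat_shift t \<omega> v"
  by (rule cpath_eqI) (simp add: path_at_prepend path_at_concat_shift)

lemma stop_prepend_iff:
  assumes "0 \<le> t"
  shows "stop_path t (prepend_path t \<omega> v) = stop_path t \<omega> \<longleftrightarrow> path_at v 0 = path_at \<omega> t"
proof
  assume "stop_path t (prepend_path t \<omega> v) = stop_path t \<omega>"
  then have "path_at (prepend_path t \<omega> v) t = path_at \<omega> t"
    using assms by (simp add: stop_path_eq_iff)
  then show "path_at v 0 = path_at \<omega> t" using assms by (simp add: path_at_prepend)
qed (use assms in \<open>auto simp: stop_path_eq_iff path_at_prepend\<close>)

text \<open>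
  If each value of \<open>f v\<close> on a bounded time interval depends without expansion on a single value of \<open>v\<close>
  on a bounded interval, then \<open>f\<close> is continuous for local uniform convergence.
\<close>

lemma continuous_on_cpathI:
  fixes f :: "'d::finite cpath \<Rightarrow> 'e::finite cpath"
  assumes "\<And>T. 0 \<le> T \<Longrightarrow> \<exists>U\<ge>0. \<forall>w v s. s \<in> {0..T} \<longrightarrow>
     (\<exists>r\<in>{0..U}. dist (path_at (f v) s) (path_at (f w) s) \<le> dist (path_at v r) (path_at w r))"
  shows "continuous_on UNIV f"
proof (subst continuous_on_open_vimage[OF open_UNIV], intro allI impI)
  fix B :: "'e cpath set" assume "open B"
  have "open (f -` B)"
    unfolding open_cpath_def
  proof
    fix w assume "w \<in> f -` B"
    then obtain T e where T: "T \<ge> 0" "e > 0"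
      "\<And>v. (\<forall>s\<in>{0..T}. dist (path_at v s) (path_at (f w) s) < e) \<Longrightarrow> v \<in> B"
      using \<open>open B\<close> unfolding open_cpath_def by (metis vimageE)
    obtain U where U: "U \<ge> 0" "\<And>w v s. s \<in> {0..T} \<Longrightarrow>
       \<exists>r\<in>{0..U}. dist (path_at (f v) s) (path_at (f w) s) \<le> dist (path_at v r) (path_at w r)"
      using assms[OF T(1)] by blast
    have "v \<in> f -` B" if v: "\<forall>s\<in>{0..U}. dist (path_at v s) (path_at w s) < e" for v
    proof (rule vimageI2, rule T(3), rule ballI)
      fix s assume "s \<in> {0..T}"
      then show "dist (path_at (f v) s) (path_at (f w) s) < e"
        using U(2)[of s v w] v by (meson le_less_trans)
    qed
    then show "\<exists>T\<ge>0. \<exists>e>0. \<forall>v. (\<forall>s\<in>{0..T}. dist (path_at v s) (path_at w s) < e) \<longrightarrow> v \<in> f -` B"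
      using U(1) T(2) by blast
  qed
  then show "open (f -` B \<inter> UNIV)" by simp
qed

lemma shift_path_measurable:
  assumes "0 \<le> t" shows "shift_path t \<in> measurable borel borel"
proof (rule borel_measurable_continuous_onI, rule continuous_on_cpathI)
  fix T :: real assume "0 \<le> T"
  then show "\<exists>U\<ge>0. \<forall>w v s. s \<in> {0..T} \<longrightarrow> (\<exists>r\<in>{0..U}.
      dist (path_at (shift_path t v) s) (path_at (shift_path t w) s) \<le> dist (path_at v r) (path_at w r))"
    using assms by (intro exI[of _ "T + t"] conjI allI impI) (auto simp: path_at_shift)
qed

lemma prepend_path_measurable: "prepend_path t \<omega> \<in> measurable borel borel"
proof (rule borel_measurable_continuous_onI, rule continuous_on_cpathI)
  fix T :: real assume T: "0 \<le> T"
  show "\<exists>U\<ge>0. \<forall>w v s. s \<in> {0..T} \<longrightarrow> (\<exists>r\<in>{0..U}.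
      dist (path_at (prepend_path t \<omega> v) s) (path_at (prepend_path t \<omega> w) s)
        \<le> dist (path_at v r) (path_at w r))"
  proof (intro exI[of _ "T + \<bar>t\<bar>"] conjI allI impI)
    fix w v :: "'a cpath" and s assume s: "s \<in> {0..T}"
    show "\<exists>r\<in>{0..T + \<bar>t\<bar>}. dist (path_at (prepend_path t \<omega> v) s) (path_at (prepend_path t \<omega> w) s)
        \<le> dist (path_at v r) (path_at w r)"
      by (rule bexI[of _ "if s < t then 0 else s - t"])
         (use s T in \<open>auto simp: path_at_prepend dist_norm\<close>)
  qed (use T in auto)
qed

lemma X_measurable:
  assumes "0 \<le> s" shows "(X s :: 'd::finite cpath \<Rightarrow> _) \<in> borel_measurable borel"
proof (rule borel_measurable_continuous_onI, subst continuous_on_open_vimage[OF open_UNIV],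
    intro allI impI)
  fix B :: "(real ^ 'd) set" assume "open B"
  have "open (X s -` B)"
    unfolding open_cpath_def
  proof
    fix w assume "w \<in> X s -` B"
    then obtain e where "e > 0" "\<And>y. dist y (X s w) < e \<Longrightarrow> y \<in> B"
      using \<open>open B\<close> unfolding open_dist by auto
    then show "\<exists>T\<ge>0. \<exists>e>0. \<forall>v. (\<forall>s\<in>{0..T}. dist (path_at v s) (path_at w s) < e) \<longrightarrow> v \<in> X s -` B"
      using assms by (intro exI[of _ s] conjI exI[of _ e]) (auto simp: X_def)
  qed
  then show "open (X s -` B \<inter> UNIV)" by simp
qed

text \<open>The fibre is closed: a path that differs from \<open>\<omega>\<close> at one time keeps doing so after small perturbations.\<close>

lemma stop_path_fibre_measurable:
  assumes "0 \<le> t" shows "{w. stop_path t w = stop_path t \<omega>} \<in> sets borel"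
proof -
  have "open (- {w. stop_path t w = stop_path t \<omega>})"
    unfolding open_cpath_def
  proof
    fix w assume "w \<in> - {w. stop_path t w = stop_path t \<omega>}"
    then obtain s where s: "s \<in> {0..t}" "path_at w s \<noteq> path_at \<omega> s"
      using stop_path_eq_iff[OF assms] by blast
    have "v \<in> - {w. stop_path t w = stop_path t \<omega>}"
      if "\<forall>r\<in>{0..t}. dist (path_at v r) (path_at w r) < dist (path_at \<omega> s) (path_at w s)" for v
    proof -
      have "dist (path_at v s) (path_at w s) < dist (path_at \<omega> s) (path_at w s)" using that s by blast
      then have "path_at v s \<noteq> path_at \<omega> s" by auto
      then show ?thesis using s by (auto simp: stop_path_eq_iff[OF assms])
    qed
    then show "\<exists>T\<ge>0. \<exists>e>0. \<forall>v. (\<forall>s\<in>{0..T}. dist (path_at v s) (path_at w s) < e) \<longrightarrow>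
        v \<in> - {w. stop_path t w = stop_path t \<omega>}"
      using assms s(2) by (intro exI[of _ t] conjI exI[of _ "dist (path_at \<omega> s) (path_at w s)"]) auto
  qed
  then show ?thesis by (metis borel_comp borel_open double_compl)
qed

section \<open>The filtration of the shifted process\<close>

lemma space_shifted_filtration: "space (shifted_filtration t s) = UNIV"
  by (simp add: shifted_filtration_def right_cont_filtration_def space_measure_of_conv)

lemma sets_natural_filtration:
  "sets (natural_filtration Y u) =
     sigma_sets UNIV {Y r -` A | r A. 0 \<le> r \<and> r \<le> u \<and> A \<in> sets borel}"
  by (simp add: natural_filtration_def)

lemma sets_right_cont_filtration:
  "sets (right_cont_filtration G s) = sigma_sets UNIV (\<Inter>u\<in>{s<..}. sets (G u))"
  by (simp add: right_cont_filtration_def)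

lemma sets_shifted_filtration_subset:
  assumes "0 \<le> t" "0 \<le> s"
  shows "sets (shifted_filtration t s :: 'd::finite cpath measure) \<subseteq> sets borel"
proof -
  have "sets (natural_filtration (shifted_X t :: _ \<Rightarrow> 'd cpath \<Rightarrow> _) u) \<subseteq> sets borel" for u
  proof -
    have "shifted_X t r -` A \<in> sets borel" if "0 \<le> r" "A \<in> sets borel"
      for r and A :: "(real ^ 'd) set"
      using measurable_sets[OF X_measurable[of "r + t"] that(2)] assms that
      by (simp add: shifted_X_def vimage_def)
    then have "{shifted_X t r -` A | r A. 0 \<le> r \<and> r \<le> u \<and> A \<in> sets borel}
        \<subseteq> sets (borel :: 'd cpath measure)" by auto
    from sets.sigma_sets_subset[OF this] show ?thesis by (simp add: sets_natural_filtration)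
  qed
  then have "(\<Inter>u\<in>{s<..}. sets (natural_filtration (shifted_X t) u))
      \<subseteq> sets (borel :: 'd cpath measure)"
    by (intro INF_lower2[of "s + 1"]) auto
  from sets.sigma_sets_subset[OF this] show ?thesis
    by (simp add: shifted_filtration_def sets_right_cont_filtration)
qed

lemma subalgebra_shifted_filtration:
  assumes "sets P = sets borel" "0 \<le> t" "0 \<le> s"
  shows "subalgebra P (shifted_filtration t s)"
  using sets_shifted_filtration_subset[OF assms(2,3)] sets_eq_imp_space_eq[OF assms(1)] assms(1)
  by (simp add: subalgebra_def space_shifted_filtration)

text \<open>
  Right limits of filtrations are intersections, with which the preimage map commutes
  because it is injective for a surjective \<open>shift_path t\<close>: an event in the intersection is the preimage of
  one and the same set for all \<open>u > s\<close>, namely of its image.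
\<close>

lemma sets_shifted_filtration_vimage:
  assumes t: "0 \<le> t"
  shows "sets (shifted_filtration t s) = {shift_path t -` A | A. A \<in> sets (shifted_filtration 0 s)}"
proof -
  let ?\<theta> = "shift_path t :: 'a cpath \<Rightarrow> 'a cpath"
  let ?N = "\<lambda>t. natural_filtration (shifted_X t :: real \<Rightarrow> 'a cpath \<Rightarrow> _)"
  have surj: "surj ?\<theta>" by (metis shift_prepend[OF t] surjI)
  have vimage_sigma: "{?\<theta> -` A | A. A \<in> sigma_sets UNIV \<A>} = sigma_sets UNIV {?\<theta> -` A | A. A \<in> \<A>}"
    for \<A> using sigma_sets_vimage_commute[of ?\<theta> UNIV UNIV \<A>] by simp
  have shifted: "shifted_X t r -` A = ?\<theta> -` (shifted_X 0 r -` A)" if "0 \<le> r" for r A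
    using that t by (auto simp: shifted_X_def X_def path_at_shift)
  have N: "sets (?N t u) = {?\<theta> -` A | A. A \<in> sets (?N 0 u)}" for u
  proof -
    let ?gen = "\<lambda>t. {shifted_X t r -` A | r A. 0 \<le> r \<and> r \<le> u \<and> A \<in> sets borel} :: 'a cpath set set"
    have "?gen t = {?\<theta> -` E | E. E \<in> ?gen 0}"
    proof (intro equalityI subsetI)
      fix E assume "E \<in> ?gen t"
      then obtain r A where "E = shifted_X t r -` A" "0 \<le> r" "r \<le> u" "A \<in> sets borel" by auto
      then show "E \<in> {?\<theta> -` E | E. E \<in> ?gen 0}"
        by (intro CollectI exI[of _ "shifted_X 0 r -` A"] conjI exI[of _ r] exI[of _ A])
           (simp_all add: shifted)
    next
      fix E assume "E \<in> {?\<theta> -` E | E. E \<in> ?gen 0}"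
      then obtain r A where "E = ?\<theta> -` (shifted_X 0 r -` A)" "0 \<le> r" "r \<le> u" "A \<in> sets borel"
        by auto
      then show "E \<in> ?gen t"
        by (intro CollectI exI[of _ r] exI[of _ A]) (simp add: shifted)
    qed
    then show ?thesis by (simp add: sets_natural_filtration vimage_sigma)
  qed
  have "(\<Inter>u\<in>{s<..}. sets (?N t u)) = {?\<theta> -` A | A. A \<in> (\<Inter>u\<in>{s<..}. sets (?N 0 u))}"
  proof (intro equalityI subsetI)
    fix E assume E: "E \<in> (\<Inter>u\<in>{s<..}. sets (?N t u))"
    have "?\<theta> ` E \<in> sets (?N 0 u) \<and> E = ?\<theta> -` (?\<theta> ` E)" if "s < u" for u
    proof -
      have "E \<in> sets (?N t u)" using E that by simp
      then obtain A where A: "A \<in> sets (?N 0 u)" "E = ?\<theta> -` A" unfolding N by blast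
      then show ?thesis using surj by (simp add: surj_image_vimage_eq)
    qed
    from this this[of "s + 1"] show "E \<in> {?\<theta> -` A | A. A \<in> (\<Inter>u\<in>{s<..}. sets (?N 0 u))}"
      by (intro CollectI exI[of _ "?\<theta> ` E"]) simp
  next
    fix E assume "E \<in> {?\<theta> -` A | A. A \<in> (\<Inter>u\<in>{s<..}. sets (?N 0 u))}"
    then show "E \<in> (\<Inter>u\<in>{s<..}. sets (?N t u))" by (auto simp: N)
  qed
  then show ?thesis
    unfolding shifted_filtration_def sets_right_cont_filtration vimage_sigma by simp
qed

text \<open>Taking preimages under a section undoes taking preimages under the shift.\<close>

lemma sets_shifted_filtration_prepend:
  assumes t: "0 \<le> t"
  shows "sets (shifted_filtration 0 s) = {prepend_path t \<omega> -` A | A. A \<in> sets (shifted_filtration t s)}"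
proof -
  have "prepend_path t \<omega> -` (shift_path t -` A) = A" for A
    by (auto simp: shift_prepend[OF t])
  then show ?thesis
    unfolding sets_shifted_filtration_vimage[OF t, of s]
    by (simp add: setcompr_eq_image image_image)
qed

section \<open>Moving laws along the shift\<close>

lemma filtered_factor_shift:
  assumes "P \<in> path_measures" "0 \<le> t"
  shows "filtered_factor P (distr P borel (shift_path t))
    (shifted_filtration t) (shifted_filtration 0) (shift_path t)"
proof -
  have P: "prob_space P" "sets P = sets borel" using assms(1) by (auto simp: path_measures_def)
  have m: "shift_path t \<in> measurable P borel"
    using shift_path_measurable[OF assms(2)] P(2) by (simp cong: measurable_cong_sets)
  show ?thesis
  proof (rule filtered_factor.intro)
    show "subalgebra P (shifted_filtration t s)"
      "subalgebra (distr P borel (shift_path t)) (shifted_filtration 0 s)" if "0 \<le> s" for s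
      using P(2) assms(2) that by (simp_all add: subalgebra_shifted_filtration)
    show "sets (shifted_filtration t s) = {shift_path t -` A | A. A \<in> sets (shifted_filtration 0 s)}"
      for s by (rule sets_shifted_filtration_vimage[OF assms(2)])
    show "distr P (distr P borel (shift_path t)) (shift_path t) = distr P borel (shift_path t)"
      by (rule distr_cong) simp_all
  qed (use P m in \<open>simp_all add: sets_eq_imp_space_eq[OF P(2)]\<close>)
qed

lemma filtered_factor_prepend:
  assumes "Q \<in> path_measures" "0 \<le> t"
  shows "filtered_factor Q (distr Q borel (prepend_path t \<omega>))
    (shifted_filtration 0) (shifted_filtration t) (prepend_path t \<omega>)"
proof -
  have Q: "prob_space Q" "sets Q = sets borel" using assms(1) by (auto simp: path_measures_def)
  have m: "prepend_path t \<omega> \<in> measurable Q borel"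
    using prepend_path_measurable Q(2) by (simp cong: measurable_cong_sets)
  show ?thesis
  proof (rule filtered_factor.intro)
    show "subalgebra Q (shifted_filtration 0 s)"
      "subalgebra (distr Q borel (prepend_path t \<omega>)) (shifted_filtration t s)" if "0 \<le> s" for s
      using Q(2) assms(2) that by (simp_all add: subalgebra_shifted_filtration)
    show "sets (shifted_filtration 0 s) =
        {prepend_path t \<omega> -` A | A. A \<in> sets (shifted_filtration t s)}"
      for s by (rule sets_shifted_filtration_prepend[OF assms(2)])
    show "distr Q (distr Q borel (prepend_path t \<omega>)) (prepend_path t \<omega>) =
        distr Q borel (prepend_path t \<omega>)"
      by (rule distr_cong) simp_all
  qed (use Q m in \<open>simp_all add: sets_eq_imp_space_eq[OF Q(2)]\<close>)
qed


lemma P_sem_ac_pullback: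
  assumes "filtered_factor P Q (shifted_filtration t) (shifted_filtration u) T"
    and X: "\<And>s w. 0 \<le> s \<Longrightarrow> shifted_X t s w = shifted_X u s (T w)"
    and P: "P \<in> path_measures" and Q: "Q \<in> P_sem_ac u"
  shows "P \<in> P_sem_ac t"
proof -
  interpret filtered_factor P Q "shifted_filtration t" "shifted_filtration u" T by fact
  obtain B C where BC: "path_characteristics u Q B C"
    "AE v in Q. locally_abs_continuous (\<lambda>s. B s v) \<and> locally_abs_continuous (\<lambda>s. C s v)"
    using Q by (auto simp: P_sem_ac_def)
  have "path_characteristics t P (\<lambda>s w. B s (T w)) (\<lambda>s w. C s (T w))"
    using characteristics_pullback[OF BC(1)[unfolded path_characteristics_def] X]
    by (simp add: path_characteristics_def)
  moreover have "continuous_semimartingale P (shifted_filtration t) (shifted_X t)"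
    using Q by (intro continuous_semimartingale_pullback[where Y = "shifted_X u" and Y' = "shifted_X t", OF _ X]) (auto simp: P_sem_ac_def P_sem_def)
  ultimately show ?thesis
    using P AE_pullback[OF BC(2)] unfolding P_sem_ac_def P_sem_def by blast
qed

text \<open>
  The constraint set \<open>\<Gamma>\<close> is kept abstract because the roles of \<^const>\<open>concat_path\<close> and
  \<^const>\<open>concat_shift\<close> are exchanged between the two directions.
\<close>

lemma differential_characteristics_pullback:
  assumes "filtered_factor P Q (shifted_filtration t) (shifted_filtration u) T"
    and X: "\<And>s w. 0 \<le> s \<Longrightarrow> shifted_X t s w = shifted_X u s (T w)"
    and \<Gamma>: "\<And>s w. \<Gamma>' s w = \<Gamma> s (T w)"
    and "\<exists>B C \<beta> \<alpha>. path_characteristics u Q B C \<and> density_process Q B \<beta> \<and> density_process Q C \<alpha> \<and>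
      (AE (s, v) in lebesgue_halfline \<Otimes>\<^sub>M Q. (\<beta> s v, \<alpha> s v) \<in> \<Gamma> s v)"
  shows "\<exists>B C \<beta> \<alpha>. path_characteristics t P B C \<and> density_process P B \<beta> \<and> density_process P C \<alpha> \<and>
      (AE (s, w) in lebesgue_halfline \<Otimes>\<^sub>M P. (\<beta> s w, \<alpha> s w) \<in> \<Gamma>' s w)"
proof -
  interpret filtered_factor P Q "shifted_filtration t" "shifted_filtration u" T by fact
  obtain B C \<beta> \<alpha> where *: "path_characteristics u Q B C" "density_process Q B \<beta>" "density_process Q C \<alpha>"
      "AE (s, v) in lebesgue_halfline \<Otimes>\<^sub>M Q. (\<beta> s v, \<alpha> s v) \<in> \<Gamma> s v"
    using assms(4) by blast
  show ?thesis
    using characteristics_pullback[OF *(1)[unfolded path_characteristics_def] X]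
      density_process_pullback[OF *(2)] density_process_pullback[OF *(3)] AE_halfline_pullback[OF *(4)]
    unfolding path_characteristics_def \<Gamma> by blast
qed

lemma distr_path_measure:
  assumes "P \<in> path_measures" "T \<in> measurable borel borel"
  shows "distr P borel T \<in> path_measures"
  using assms prob_space.prob_space_distr[of P T borel]
  by (auto simp: path_measures_def cong: measurable_cong_sets)

lemma path_measure_measurable:
  assumes "P \<in> path_measures" "T \<in> measurable borel N"
  shows "T \<in> measurable P N"
  using assms by (auto simp: path_measures_def cong: measurable_cong_sets)

lemma path_measure_distr_cancel:
  assumes "P \<in> path_measures" "T \<in> measurable borel borel" "S \<in> measurable borel borel"
    and "AE w in P. S (T w) = w"
  shows "distr (distr P borel T) borel S = P"
proof -
  have "distr (distr P borel T) borel S = distr P borel (\<lambda>w. S (T w))"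
    using distr_distr[OF assms(3) path_measure_measurable[OF assms(1,2)]] by (simp add: comp_def)
  also have "\<dots> = distr P P (\<lambda>w. w)"
  proof (rule distr_cong_AE)
    show "sets borel = sets P" using assms(1) by (simp add: path_measures_def)
    show "AE w in P. S (T w) = w" by fact
  qed (use path_measure_measurable[OF assms(1) measurable_compose[OF assms(2,3)]] in simp_all)
  finally show ?thesis by simp
qed

lemma law_C_AE_past:
  assumes "P \<in> law_C b a t \<omega>"
  shows "AE w in P. stop_path t w = stop_path t \<omega>"
proof -
  have P: "prob_space P" "measure P {w. stop_path t w = stop_path t \<omega>} = 1"
    using assms(1) by (simp_all add: law_C_def P_sem_ac_def P_sem_def path_measures_def)
  then show ?thesis using prob_space.AE_prob_1[OF P] by simp
qed

lemma law_R_AE_start: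
  assumes "Q \<in> law_R b a t \<omega>"
  shows "AE v in Q. path_at v 0 = path_at \<omega> t"
proof -
  have Q: "Q \<in> path_measures" "distr Q borel (X 0) = return borel (X t \<omega>)"
    using assms by (auto simp: law_R_def P_sem_ac_def P_sem_def)
  have "AE y in distr Q borel (X 0). y = X t \<omega>"
    unfolding Q(2) by (subst AE_return) auto
  from AE_distrD[OF path_measure_measurable[OF Q(1) X_measurable] this]
  show ?thesis by (simp add: X_def)
qed

text \<open>
  Characteristics are transported against the direction of the factor map. To reach the image under the
  shift, the factor map needed is thus the section \<open>prepend_path t \<omega>\<close>, which carries that image back to \<open>P\<close>
  since \<open>P\<close> fixes the past.
\<close>

lemma distr_shift_law_C:
  fixes P :: "'d::finite cpath measure"
  assumes P: "P \<in> law_C b a t \<omega>" and t: "0 \<le> t"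
  shows "distr P borel (shift_path t) \<in> law_R b a t \<omega>"
    and "distr (distr P borel (shift_path t)) borel (prepend_path t \<omega>) = P"
proof -
  let ?Q = "distr P borel (shift_path t)"
  have pm: "P \<in> path_measures" using P by (auto simp: law_C_def P_sem_ac_def P_sem_def)
  then have P': "prob_space P" "sets P = sets borel" by (auto simp: path_measures_def)
  note ae = law_C_AE_past[OF P]
  have Q: "?Q \<in> path_measures" by (rule distr_path_measure[OF pm shift_path_measurable[OF t]])
  have QP: "distr ?Q borel (prepend_path t \<omega>) = P"
    by (rule path_measure_distr_cancel[OF pm shift_path_measurable[OF t] prepend_path_measurable])
       (use ae in \<open>rule AE_mp, simp add: prepend_shift[OF t]\<close>)
  then show "distr ?Q borel (prepend_path t \<omega>) = P" .
  have ff: "filtered_factor ?Q P (shifted_filtration 0) (shifted_filtration t) (prepend_path t \<omega>)"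
    using filtered_factor_prepend[OF Q t, of \<omega>] by (simp add: QP)
  have X: "shifted_X 0 s v = shifted_X t s (prepend_path t \<omega> v)" if "0 \<le> s" for s and v :: "'d cpath"
    using that t by (simp add: shifted_X_def X_def path_at_prepend)
  have "?Q \<in> P_sem_ac 0"
    by (rule P_sem_ac_pullback[OF ff X Q]) (use P in \<open>auto simp: law_C_def\<close>)
  moreover have "distr ?Q borel (X 0) = return borel (X t \<omega>)"
  proof -
    have "distr ?Q borel (X 0) = distr P borel (\<lambda>w. X 0 (shift_path t w))"
      using distr_distr[OF X_measurable path_measure_measurable[OF pm shift_path_measurable[OF t]], of 0]
      by (simp add: comp_def)
    also have "\<dots> = distr P borel (\<lambda>_. X t \<omega>)"
    proof (rule distr_cong_AE)
      show "AE w in P. X 0 (shift_path t w) = X t \<omega>"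
        using ae by (rule AE_mp) (simp add: X_def path_at_shift stop_path_eq_iff t)
    qed (use path_measure_measurable[OF pm measurable_compose[OF shift_path_measurable[OF t]
          X_measurable[of 0]]] in auto)
    also have "\<dots> = return borel (X t \<omega>)"
      using prob_space.emeasure_space_1[OF P'(1)]
      by (intro measure_eqI) (auto simp: emeasure_distr indicator_def)
    finally show ?thesis .
  qed
  moreover have "\<exists>B C \<beta> \<alpha>. path_characteristics 0 ?Q B C \<and> density_process ?Q B \<beta> \<and>
      density_process ?Q C \<alpha> \<and> (AE (s, v) in lebesgue_halfline \<Otimes>\<^sub>M ?Q.
        (\<beta> s v, \<alpha> s v) \<in> \<Theta> b a (s + t) (concat_shift t \<omega> v))"
    by (rule differential_characteristics_pullback[OF ff X,
          of _ "\<lambda>s w. \<Theta> b a (s + t) (concat_path t \<omega> w)"])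
       (use P in \<open>auto simp: law_C_def concat_path_prepend[OF t]\<close>)
  ultimately show "?Q \<in> law_R b a t \<omega>" by (simp add: law_R_def)
qed

text \<open>
  Here the factor map is the shift, which inverts \<open>prepend_path t \<omega>\<close> everywhere. The law of \<open>X\<^sub>0\<close> makes the
  translation of the prepended piece trivial, so that the past is \<open>\<omega>\<close> itself.
\<close>

lemma distr_prepend_law_R:
  fixes Q :: "'d::finite cpath measure"
  assumes Q: "Q \<in> law_R b a t \<omega>" and t: "0 \<le> t"
  shows "distr Q borel (prepend_path t \<omega>) \<in> law_C b a t \<omega>"
proof -
  let ?P = "distr Q borel (prepend_path t \<omega>)"
  have pm: "Q \<in> path_measures" using Q by (auto simp: law_R_def P_sem_ac_def P_sem_def)
  then have Q': "prob_space Q" "sets Q = sets borel" by (auto simp: path_measures_def)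
  note \<sigma> = path_measure_measurable[OF pm prepend_path_measurable]
  have P: "?P \<in> path_measures" by (rule distr_path_measure[OF pm prepend_path_measurable])
  have PQ: "distr ?P borel (shift_path t) = Q"
    by (rule path_measure_distr_cancel[OF pm prepend_path_measurable shift_path_measurable[OF t]])
       (simp add: shift_prepend[OF t])
  have ff: "filtered_factor ?P Q (shifted_filtration t) (shifted_filtration 0) (shift_path t)"
    using filtered_factor_shift[OF P t] by (simp add: PQ)
  have X: "shifted_X t s w = shifted_X 0 s (shift_path t w)" if "0 \<le> s" for s and w :: "'d cpath"
    using that t by (simp add: shifted_X_def X_def path_at_shift)
  have "?P \<in> P_sem_ac t"
    by (rule P_sem_ac_pullback[OF ff X P]) (use Q in \<open>auto simp: law_R_def\<close>)
  moreover have "measure ?P {w. stop_path t w = stop_path t \<omega>} = 1"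
  proof -
    let ?S = "{w. stop_path t w = stop_path t \<omega>}"
    interpret Q: prob_space Q by (rule Q'(1))
    have "measure ?P ?S = measure Q (prepend_path t \<omega> -` ?S \<inter> space Q)"
      by (rule measure_distr[OF \<sigma> stop_path_fibre_measurable[OF t]])
    also have "\<dots> = 1"
    proof (subst Q.prob_eq_1)
      show "prepend_path t \<omega> -` ?S \<inter> space Q \<in> sets Q"
        by (rule measurable_sets[OF \<sigma> stop_path_fibre_measurable[OF t]])
      show "AE v in Q. v \<in> prepend_path t \<omega> -` ?S \<inter> space Q"
        using law_R_AE_start[OF Q] by (rule AE_mp) (simp add: stop_prepend_iff[OF t])
    qed
    finally show ?thesis .
  qed
  moreover have "\<exists>B C \<beta> \<alpha>. path_characteristics t ?P B C \<and> density_process ?P B \<beta> \<and>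
      density_process ?P C \<alpha> \<and> (AE (s, w) in lebesgue_halfline \<Otimes>\<^sub>M ?P.
        (\<beta> s w, \<alpha> s w) \<in> \<Theta> b a (s + t) (concat_path t \<omega> w))"
    by (rule differential_characteristics_pullback[OF ff X,
          of _ "\<lambda>s v. \<Theta> b a (s + t) (concat_shift t \<omega> v)"])
       (use Q in \<open>auto simp: law_R_def concat_shift_shift[OF t]\<close>)
  ultimately show ?thesis by (simp add: law_C_def)
qed

lemma law_C_eq_image:
  assumes "0 \<le> t"
  shows "law_C b a t \<omega> = (\<lambda>Q. distr Q borel (prepend_path t \<omega>)) ` law_R b a t \<omega>"
proof (intro equalityI subsetI)
  fix P assume "P \<in> law_C b a t \<omega>"
  from distr_shift_law_C[OF this assms]
  show "P \<in> (\<lambda>Q. distr Q borel (prepend_path t \<omega>)) ` law_R b a t \<omega>"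
    by (intro image_eqI[OF sym])
qed (use distr_prepend_law_R[OF _ assms] in blast)

text \<open>
  Under a law that starts at \<open>\<omega> t\<close>, the two ways of gluing \<open>\<omega>\<close> to a path agree almost surely.
\<close>

lemma completed_expectation_prepend:
  assumes Q: "Q \<in> law_R b a t \<omega>" and t: "0 \<le> t"
  shows "completed_expectation (distr Q borel (prepend_path t \<omega>)) \<psi> =
    completed_expectation Q (\<lambda>v. \<psi> (concat_shift t \<omega> v))"
proof -
  let ?P = "distr Q borel (prepend_path t \<omega>)"
  have pm: "Q \<in> path_measures" using Q by (auto simp: law_R_def P_sem_ac_def P_sem_def)
  have \<theta>: "shift_path t \<in> measurable borel Q"
    using shift_path_measurable[OF t] pm by (auto simp: path_measures_def cong: measurable_cong_sets)
  have "AE w in ?P. prepend_path t \<omega> (shift_path t w) = w"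
    using law_C_AE_past[OF distr_prepend_law_R[OF Q t]]
    by (rule AE_mp) (simp add: prepend_shift[OF t])
  then have "integral\<^sup>N ?P f = (\<integral>\<^sup>+ v. f (prepend_path t \<omega> v) \<partial>Q)" for f
    by (intro nn_integral_distr_invertible[OF path_measure_measurable[OF pm prepend_path_measurable] \<theta>])
       (simp_all add: shift_prepend[OF t])
  also have "(\<integral>\<^sup>+ v. f (prepend_path t \<omega> v) \<partial>Q) = (\<integral>\<^sup>+ v. f (concat_shift t \<omega> v) \<partial>Q)" for f
    by (rule nn_integral_cong_AE, rule AE_mp[OF law_R_AE_start[OF Q]])
       (simp add: prepend_eq_concat_shift)
  finally have "integral\<^sup>N ?P f = (\<integral>\<^sup>+ v. f (concat_shift t \<omega> v) \<partial>Q)" for f .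
  then show ?thesis by (simp add: completed_expectation_def nn_integral_completion)
qed

theorem corollary7p3:
  fixes b :: "'f::topological_space \<Rightarrow> real \<Rightarrow> 'd::finite cpath \<Rightarrow> real ^ 'd"
    and a :: "'f \<Rightarrow> real \<Rightarrow> 'd cpath \<Rightarrow> real ^ 'd ^ 'd"
    and \<psi> :: "'d cpath \<Rightarrow> real"
    and t :: real and \<omega> :: "'d cpath"
  assumes F_metrizable: "metrizable_space (euclidean :: 'f topology)"
    and b_borel: "(\<lambda>(f, s, w). b f s w) \<in> borel_measurable (restrict_space borel (UNIV \<times> {0..} \<times> UNIV))"
    and a_borel: "(\<lambda>(f, s, w). a f s w) \<in> borel_measurable (restrict_space borel (UNIV \<times> {0..} \<times> UNIV))"
    and a_psd: "\<And>f s w. 0 \<le> s \<Longrightarrow> a f s w \<in> psd_matrices"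
    and b_predictable: "\<And>f. predictable (natural_filtration X) (b f)"
    and a_predictable: "\<And>f. predictable (natural_filtration X) (a f)"
    and graph_borel: "{(s, w, y, A). 0 \<le> s \<and> (y, A) \<in> \<Theta> b a s w}
          \<in> sets (restrict_space borel ({0..} \<times> UNIV \<times> UNIV \<times> psd_matrices))"
    and C_nonempty: "\<And>s w. 0 \<le> s \<Longrightarrow> law_C b a s w \<noteq> {}"
    and psi_usa: "upper_semianalytic \<psi>"
    and t_nonneg: "0 \<le> t"
  shows "(SUP P\<in>law_C b a t \<omega>. completed_expectation P \<psi>) =
         (SUP P\<in>law_R b a t \<omega>. completed_expectation P (\<lambda>w. \<psi> (concat_shift t \<omega> w)))"
  unfolding law_C_eq_image[OF t_nonneg] image_image
  by (rule SUP_cong[OF refl], rule completed_expectation_prepend[OF _ t_nonneg])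

end
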